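(* Let $R$ be a range set, $X$ an ultraparacompact Hausdorff space, and $\mathcal{C}$ an open covering of $X$. Then the set $\mathrm{UL}(\mathcal{C};R)$ of all $d\in\mathrm{UCPM}(X,R)$ such that $\mathcal{C}$ has a (positive) Lebesgue number with respect to $d$ is open and dense in $(\mathrm{UCPM}(X,R),\mathcal{UD}_X^R)$.
   Context: A range set is a set $R\subseteq[0,\infty)$ with $0\in R$. A topological space $X$ is ultraparacompact if every open covering of $X$ has a refinement that is a covering of $X$ consisting of (pairwise) disjoint open subsets. Write $x\lor y=\max\{x,y\}$. A pseudo-ultrametric on a set $X$ is a map $d\colon X\times X\to[0,\infty)$ with $d(x,x)=0$, $d(x,y)=d(y,x)$ and $d(x,y)\le d(x,z)\lor d(z,y)$ for all $x,y,z\in X$. It is $R$-valued if $d(x,y)\in R$ for all $x,y\in X$. For a topological space $X$, $\mathrm{UCPM}(X,R)$ denotes the set of all $R$-valued pseudo-ultrametrics on $X$ that are continuous as maps $X\times X\to[0,\infty)$. For $d,e\in\mathrm{UCPM}(X,R)$, $\mathcal{UD}_X^R(d,e)\in[0,\infty]$ is the infimum of all $\epsilon\in R$ such that $d(x,y)\le e(x,y)\lor\epsilon$ and $e(x,y)\le d(x,y)\lor\epsilon$ for all $x,y\in X$ (with $\inf\emptyset=\infty$). This is an ultrametric with values in $[0,\infty]$, and $\mathrm{UCPM}(X,R)$ carries the topology it induces via open balls. For a pseudometric $d$ on $X$, $x\in X$ and $r\in(0,\infty)$, put $U(x,r;d)=\{p\in X\mid d(x,p)<r\}$. Given a covering $\mathcal{C}=\{C_i\}_{i\in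 I}$ of $X$, a number $r\in(0,\infty)$ is a Lebesgue number of $\mathcal{C}$ with respect to $d$ if for every $x\in X$ there exists $i\in I$ with $U(x,r;d)\subseteq C_i$.
   Formalization: Density is claimed only when 0 is a limit point of R (R has arbitrarily small positive elements); it fails otherwise, e.g. for R = {0}, X a two-point discrete space covered by its singletons. Openness is claimed for every range set R. *)

theory Defs
  imports "HOL-Analysis.Analysis"
begin

definition range_set :: "real set \<Rightarrow> bool" where
  "range_set R \<longleftrightarrow> R \<subseteq> {0..} \<and> 0 \<in> R"

definition open_covering :: "'a topology \<Rightarrow> 'a set set \<Rightarrow> bool" where
  "open_covering X \<C> \<longleftrightarrow> (\<forall>C\<in>\<C>. openin X C) \<and> \<Union>\<C> = topspace X"

definition ultraparacompact_space :: "'a topology \<Rightarrow> bool" where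
  "ultraparacompact_space X \<longleftrightarrow>
     (\<forall>\<C>. open_covering X \<C> \<longrightarrow>
        (\<exists>\<V>. open_covering X \<V> \<and> pairwise disjnt \<V> \<and> (\<forall>V\<in>\<V>. \<exists>C\<in>\<C>. V \<subseteq> C)))"

definition pseudo_ultrametric_on :: "'a set \<Rightarrow> ('a \<times> 'a \<Rightarrow> real) \<Rightarrow> bool" where
  "pseudo_ultrametric_on S d \<longleftrightarrow>
     d \<in> S \<times> S \<rightarrow> {0..} \<and>
     (\<forall>x\<in>S. d (x, x) = 0) \<and>
     (\<forall>x\<in>S. \<forall>y\<in>S. d (x, y) = d (y, x)) \<and>
     (\<forall>x\<in>S. \<forall>y\<in>S. \<forall>z\<in>S. d (x, y) \<le> max (d (x, z)) (d (z, y)))"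

text \<open>
  Membership in \<^const>\<open>extensional\<close> makes the elements correspond exactly to the maps with
  domain \<open>topspace X \<times> topspace X\<close>: their values elsewhere carry no information.
\<close>

definition UCPM :: "'a topology \<Rightarrow> real set \<Rightarrow> ('a \<times> 'a \<Rightarrow> real) set" where
  "UCPM X R =
     {d \<in> extensional (topspace X \<times> topspace X).
        pseudo_ultrametric_on (topspace X) d \<and>
        d \<in> topspace X \<times> topspace X \<rightarrow> R \<and>
        continuous_map (prod_topology X X) (top_of_set {0..}) d}"

text \<open>The infimum is taken in \<^typ>\<open>ennreal\<close>, so the infimum of the empty set is \<open>\<infinity>\<close>.\<close>

definition UD :: "'a topology \<Rightarrow> real set \<Rightarrow> ('a \<times> 'a \<Rightarrow> real) \<Rightarrow> ('a \<times> 'a \<Rightarrow> real) \<Rightarrow> ennreal" where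
  "UD X R d e =
     Inf (ennreal ` {\<epsilon> \<in> R. \<forall>x\<in>topspace X. \<forall>y\<in>topspace X.
       d (x, y) \<le> max (e (x, y)) \<epsilon> \<and> e (x, y) \<le> max (d (x, y)) \<epsilon>})"

definition UD_ball :: "'a topology \<Rightarrow> real set \<Rightarrow> ('a \<times> 'a \<Rightarrow> real) \<Rightarrow> real \<Rightarrow> ('a \<times> 'a \<Rightarrow> real) set" where
  "UD_ball X R d r = {e \<in> UCPM X R. UD X R d e < ennreal r}"

definition UCPM_topology :: "'a topology \<Rightarrow> real set \<Rightarrow> ('a \<times> 'a \<Rightarrow> real) topology" where
  "UCPM_topology X R = topology_generated_by {UD_ball X R d r | d r. d \<in> UCPM X R \<and> 0 < r}"

definition pseudo_ball :: "'a set \<Rightarrow> ('a \<times> 'a \<Rightarrow> real) \<Rightarrow> 'a \<Rightarrow> real \<Rightarrow> 'a set" where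
  "pseudo_ball S d x r = {p \<in> S. d (x, p) < r}"

definition lebesgue_number_on :: "'a set \<Rightarrow> ('a \<times> 'a \<Rightarrow> real) \<Rightarrow> 'a set set \<Rightarrow> real \<Rightarrow> bool" where
  "lebesgue_number_on S d \<C> r \<longleftrightarrow> 0 < r \<and> (\<forall>x\<in>S. \<exists>C\<in>\<C>. pseudo_ball S d x r \<subseteq> C)"

definition UL :: "'a topology \<Rightarrow> 'a set set \<Rightarrow> real set \<Rightarrow> ('a \<times> 'a \<Rightarrow> real) set" where
  "UL X \<C> R = {d \<in> UCPM X R. \<exists>r. lebesgue_number_on (topspace X) d \<C> r}"

text \<open>
  \<open>UL X \<C> R\<close> can fail to be dense when \<open>0\<close> is an isolated point of \<open>R\<close>. If \<open>R = {0}\<close>, \<open>X\<close> is the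
  discrete space with exactly two points \<open>a\<close>, \<open>b\<close>, and \<open>\<C> = {{a}, {b}}\<close>, then \<open>UCPM X R\<close> consists
  of the zero map only, for which \<open>\<C>\<close> has no Lebesgue number. So density is to be claimed under
  \<open>0 islimpt R\<close>, which for a range set says that \<open>R\<close> has arbitrarily small positive elements;
  openness holds for every range set.
\<close>

end

theory Submission
  imports Defs
begin

text \<open>
  Call two pseudo-ultrametrics \<open>\<epsilon>\<close>-close if each is bounded by the maximum of the other and
  \<open>\<epsilon>\<close>. The constants \<open>\<epsilon>\<close> never add up: \<open>\<epsilon>\<close>-closeness followed by \<open>\<delta>\<close>-closeness is
  \<open>max \<epsilon> \<delta>\<close>-closeness, and this maximum again lies in \<open>R\<close>. Therefore every point of a ball is a
  centre of it, and the balls around \<open>d\<close> form a neighbourhood base at \<open>d\<close>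
  (\<open>UD_ball_recentre\<close>, \<open>openin_UCPM_topology_iff\<close>).

  Openness holds because a Lebesgue number \<open>r\<close> of \<open>d\<close> is also one of every \<open>e\<close> that is \<open>\<epsilon>\<close>-close
  to \<open>d\<close> with \<open>\<epsilon> < r\<close>: from \<open>e (x, p) < r\<close> follows \<open>d (x, p) \<le> max (e (x, p)) \<epsilon> < r\<close>.

  For density, let \<open>d\<close> be given and let \<open>\<eta> \<in> R\<close> be positive and small. Ultraparacompactness
  yields a partition \<open>\<V>\<close> of the space into open sets that refines \<open>\<C>\<close>. The map equal to \<open>0\<close> on
  pairs inside one block and to \<open>\<eta>\<close> on all other pairs is a pseudo-ultrametric, and it is
  continuous because it is constant on the open boxes \<open>V \<times> W\<close> with \<open>V, W \<in> \<V>\<close>. Its pointwise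
  maximum with \<open>d\<close> is \<open>\<eta>\<close>-close to \<open>d\<close>. The \<open>\<eta>\<close>-balls of this maximum lie inside blocks, so
  \<open>\<eta>\<close> is a Lebesgue number of \<open>\<C>\<close> for it.
\<close>

section \<open>Balls as a neighbourhood base\<close>

definition close_on :: "'a set \<Rightarrow> real \<Rightarrow> ('a \<times> 'a \<Rightarrow> real) \<Rightarrow> ('a \<times> 'a \<Rightarrow> real) \<Rightarrow> bool" where
  "close_on S \<epsilon> d e \<longleftrightarrow>
     (\<forall>x\<in>S. \<forall>y\<in>S. d (x, y) \<le> max (e (x, y)) \<epsilon> \<and> e (x, y) \<le> max (d (x, y)) \<epsilon>)"

lemma close_on_trans:
  assumes "close_on S \<epsilon> c d" "close_on S \<delta> d e"
  shows "close_on S (max \<epsilon> \<delta>) c e"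
  unfolding close_on_def
proof (intro ballI)
  fix x y assume "x \<in> S" "y \<in> S"
  then have "c (x, y) \<le> max (d (x, y)) \<epsilon>" "d (x, y) \<le> max (c (x, y)) \<epsilon>"
    "d (x, y) \<le> max (e (x, y)) \<delta>" "e (x, y) \<le> max (d (x, y)) \<delta>"
    using assms unfolding close_on_def by blast+
  then show "c (x, y) \<le> max (e (x, y)) (max \<epsilon> \<delta>) \<and> e (x, y) \<le> max (c (x, y)) (max \<epsilon> \<delta>)"
    by linarith
qed

text \<open>
  Membership in a ball needs only one witness \<open>\<epsilon>\<close> below the radius, so from here on no infimum has
  to be handled; \<open>R \<subseteq> {0..}\<close> is what makes the embedding into \<^typ>\<open>ennreal\<close> faithful on the witnesses.
\<close>

lemma UD_less_iff:
  assumes "range_set R"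
  shows "UD X R d e < ennreal r \<longleftrightarrow> (\<exists>\<epsilon>\<in>R. \<epsilon> < r \<and> close_on (topspace X) \<epsilon> d e)"
proof -
  have "ennreal \<epsilon> < ennreal r \<longleftrightarrow> \<epsilon> < r" if "\<epsilon> \<in> R" for \<epsilon>
    using assms that by (intro ennreal_less_iff) (auto simp: range_set_def)
  then show ?thesis
    unfolding UD_def Inf_less_iff close_on_def by auto
qed

lemma UD_ball_iff:
  assumes "range_set R"
  shows "e \<in> UD_ball X R d r \<longleftrightarrow>
    e \<in> UCPM X R \<and> (\<exists>\<epsilon>\<in>R. \<epsilon> < r \<and> close_on (topspace X) \<epsilon> d e)"
  by (simp add: UD_ball_def UD_less_iff[OF assms])

lemma centre_in_UD_ball:
  assumes "range_set R" "d \<in> UCPM X R" "0 < r"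
  shows "d \<in> UD_ball X R d r"
proof -
  have "0 \<in> R" "close_on (topspace X) 0 d d"
    using assms(1) by (auto simp: range_set_def close_on_def)
  with assms show ?thesis by (auto simp: UD_ball_iff)
qed

text \<open>
  The ultrametric phenomenon: the witnesses \<open>\<epsilon>, \<delta> < r\<close> combine to \<open>max \<epsilon> \<delta> < r\<close>, which is one of
  the two and so an element of \<open>R\<close>.
\<close>

lemma UD_ball_recentre:
  assumes "range_set R" "d \<in> UD_ball X R c r"
  shows "UD_ball X R d r \<subseteq> UD_ball X R c r"
proof
  fix e assume "e \<in> UD_ball X R d r"
  with assms obtain \<epsilon> \<delta> where
    "e \<in> UCPM X R" "\<epsilon> \<in> R" "\<epsilon> < r" "close_on (topspace X) \<epsilon> c d"
    "\<delta> \<in> R" "\<delta> < r" "close_on (topspace X) \<delta> d e"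
    by (auto simp: UD_ball_iff)
  moreover from this have "close_on (topspace X) (max \<epsilon> \<delta>) c e" "max \<epsilon> \<delta> \<in> R" "max \<epsilon> \<delta> < r"
    by (blast intro: close_on_trans, auto simp: max_def)
  ultimately show "e \<in> UD_ball X R c r"
    unfolding UD_ball_iff[OF assms(1)] by blast
qed

lemma topspace_UCPM_topology:
  assumes "range_set R"
  shows "topspace (UCPM_topology X R) = UCPM X R"
proof
  show "topspace (UCPM_topology X R) \<subseteq> UCPM X R"
    by (auto simp: UCPM_topology_def UD_ball_def)
  show "UCPM X R \<subseteq> topspace (UCPM_topology X R)"
  proof
    fix d assume "d \<in> UCPM X R"
    with centre_in_UD_ball[OF assms this zero_less_one] zero_less_one
    show "d \<in> topspace (UCPM_topology X R)"
      unfolding UCPM_topology_def topology_generated_by_topspace by blast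
  qed
qed

text \<open>
  The balls are only given as a subbase; that finite intersections add nothing is due to
  recentring, which lets concentric balls be compared by their radii.
\<close>

lemma openin_UCPM_topology_iff:
  assumes "range_set R"
  shows "openin (UCPM_topology X R) W \<longleftrightarrow>
    W \<subseteq> UCPM X R \<and> (\<forall>d\<in>W. \<exists>r>0. UD_ball X R d r \<subseteq> W)"
    (is "_ \<longleftrightarrow> _ \<and> ?nbhd W")
proof (intro iffI conjI)
  assume W: "openin (UCPM_topology X R) W"
  then show "W \<subseteq> UCPM X R"
    using openin_subset topspace_UCPM_topology[OF assms] by blast
  from W have "generate_topology_on {UD_ball X R d r |d r. d \<in> UCPM X R \<and> 0 < r} W"
    by (simp add: UCPM_topology_def openin_topology_generated_by_iff)
  then show "?nbhd W"
  proof induction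
    case (Int A B)
    show ?case
    proof
      fix d assume "d \<in> A \<inter> B"
      with Int.IH obtain r s where
        "r > 0" "s > 0" "UD_ball X R d r \<subseteq> A" "UD_ball X R d s \<subseteq> B" by blast
      moreover have "UD_ball X R d (min r s) \<subseteq> UD_ball X R d r \<inter> UD_ball X R d s"
        by (auto simp: UD_ball_iff[OF assms])
      ultimately have "min r s > 0" "UD_ball X R d (min r s) \<subseteq> A \<inter> B" by auto
      then show "\<exists>r>0. UD_ball X R d r \<subseteq> A \<inter> B" by blast
    qed
  next
    case (UN K)
    then show ?case by (meson UnionE Union_upper subset_trans)
  next
    case (Basis B)
    then show ?case using UD_ball_recentre[OF assms] by blast
  qed simp
next
  assume W: "W \<subseteq> UCPM X R \<and> ?nbhd W"
  show "openin (UCPM_topology X R) W"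
  proof (subst openin_subopen, rule ballI)
    fix d assume "d \<in> W"
    with W obtain r where "d \<in> UCPM X R" "r > 0" "UD_ball X R d r \<subseteq> W" by blast
    moreover from this have "openin (UCPM_topology X R) (UD_ball X R d r)"
      unfolding UCPM_topology_def by (intro topology_generated_by_Basis) blast
    ultimately show "\<exists>T. openin (UCPM_topology X R) T \<and> d \<in> T \<and> T \<subseteq> W"
      using centre_in_UD_ball[OF assms] by blast
  qed
qed

section \<open>Stability of Lebesgue numbers\<close>

text \<open>
  Because \<open>\<epsilon> < r\<close>, the bound \<open>d \<le> max e \<epsilon>\<close> makes every \<open>r\<close>-ball of \<open>e\<close> part of the \<open>r\<close>-ball of \<open>d\<close>
  with the same centre, and the Lebesgue number is inherited without loss.
\<close>

lemma lebesgue_number_on_close: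
  assumes "lebesgue_number_on S d \<C> r" "close_on S \<epsilon> d e" "\<epsilon> < r"
  shows "lebesgue_number_on S e \<C> r"
proof -
  have "pseudo_ball S e x r \<subseteq> pseudo_ball S d x r" if "x \<in> S" for x
    using assms(2,3) that unfolding close_on_def pseudo_ball_def
    by (force simp: max_def split: if_splits)
  then show ?thesis
    using assms(1) unfolding lebesgue_number_on_def by (meson subset_trans)
qed

section \<open>The pseudo-ultrametric of an open partition\<close>

definition partition_dist :: "'a set set \<Rightarrow> real \<Rightarrow> 'a \<times> 'a \<Rightarrow> real" where
  "partition_dist \<V> \<eta> p = (if \<exists>V\<in>\<V>. fst p \<in> V \<and> snd p \<in> V then 0 else \<eta>)"

text \<open>
  The triangle inequality could only fail if \<open>x, z\<close> share a block and \<open>z, y\<close> share a block; both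
  blocks contain \<open>z\<close>, so disjointness identifies them.
\<close>

lemma pseudo_ultrametric_partition_dist:
  assumes "pairwise disjnt \<V>" "\<Union>\<V> = S" "0 \<le> \<eta>"
  shows "pseudo_ultrametric_on S (partition_dist \<V> \<eta>)"
proof -
  have "partition_dist \<V> \<eta> (x, y) \<le>
      max (partition_dist \<V> \<eta> (x, z)) (partition_dist \<V> \<eta> (z, y))" for x y z
  proof (cases "(\<exists>V\<in>\<V>. x \<in> V \<and> z \<in> V) \<and> (\<exists>W\<in>\<V>. z \<in> W \<and> y \<in> W)")
    case True
    then obtain V W where "V \<in> \<V>" "x \<in> V" "z \<in> V" "W \<in> \<V>" "z \<in> W" "y \<in> W" by blast
    moreover from this have "V = W"
      using assms(1) unfolding pairwise_def disjnt_iff by metis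
    ultimately have "\<exists>V\<in>\<V>. x \<in> V \<and> y \<in> V" by blast
    then show ?thesis using assms(3) by (simp add: partition_dist_def)
  next
    case False
    then show ?thesis using assms(3) by (auto simp: partition_dist_def)
  qed
  then show ?thesis
    using assms(2,3) unfolding pseudo_ultrametric_on_def by (auto simp: partition_dist_def)
qed

lemma continuous_map_partition_dist:
  assumes "open_covering X \<V>" "pairwise disjnt \<V>"
  shows "continuous_map (prod_topology X X) euclideanreal (partition_dist \<V> \<eta>)"
  unfolding continuous_map_def
proof (intro conjI allI impI)
  fix U :: "real set"
  let ?P = "{p \<in> topspace (prod_topology X X). partition_dist \<V> \<eta> p \<in> U}"
  show "openin (prod_topology X X) ?P"
  proof (subst openin_subopen, rule ballI)
    fix p assume p: "p \<in> ?P"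
    then have "fst p \<in> \<Union>\<V>" "snd p \<in> \<Union>\<V>"
      using assms(1) by (auto simp: open_covering_def)
    then obtain V W where VW: "V \<in> \<V>" "W \<in> \<V>" "p \<in> V \<times> W"
      unfolding mem_Times_iff by blast
    have box: "openin (prod_topology X X) (V \<times> W)"
      using VW assms(1) by (auto simp: open_covering_def openin_prod_Times_iff)
    \<comment> \<open>By disjointness, a point of \<open>V \<times> W\<close> has both coordinates in one block iff \<open>V = W\<close>.\<close>
    have const: "partition_dist \<V> \<eta> q = partition_dist \<V> \<eta> p" if "q \<in> V \<times> W" for q
    proof -
      have "(\<exists>Z\<in>\<V>. fst q \<in> Z \<and> snd q \<in> Z) \<longleftrightarrow> V = W" if "q \<in> V \<times> W" for q
        using that VW(1,2) assms(2) unfolding pairwise_def disjnt_iff mem_Times_iff by metis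
      with that VW(3) show ?thesis by (simp add: partition_dist_def)
    qed
    show "\<exists>T. openin (prod_topology X X) T \<and> p \<in> T \<and> T \<subseteq> ?P"
    proof (intro exI[of _ "V \<times> W"] conjI subsetI)
      fix q assume "q \<in> V \<times> W"
      then show "q \<in> ?P" using const p openin_subset[OF box] by auto
    qed (use VW(3) box in auto)
  qed
qed simp

section \<open>Refining a pseudo-ultrametric by a partition\<close>

lemma pseudo_ultrametric_max:
  assumes "pseudo_ultrametric_on S d" "pseudo_ultrametric_on S e"
  shows "pseudo_ultrametric_on S (\<lambda>p. max (d p) (e p))"
proof -
  have "max (d (x, y)) (e (x, y)) \<le> max (max (d (x, z)) (e (x, z))) (max (d (z, y)) (e (z, y)))"
    if "x \<in> S" "y \<in> S" "z \<in> S" for x y z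
  proof -
    have "d (x, y) \<le> max (d (x, z)) (d (z, y))" "e (x, y) \<le> max (e (x, z)) (e (z, y))"
      using assms that unfolding pseudo_ultrametric_on_def by blast+
    then show ?thesis by linarith
  qed
  moreover have "max (d (x, y)) (e (x, y)) = max (d (y, x)) (e (y, x))"
    if "x \<in> S" "y \<in> S" for x y
    using assms that unfolding pseudo_ultrametric_on_def by metis
  moreover have "max (d p) (e p) \<ge> 0" if "p \<in> S \<times> S" for p
    using assms(1) that unfolding pseudo_ultrametric_on_def by (auto simp: Pi_iff le_max_iff_disj)
  ultimately show ?thesis
    using assms unfolding pseudo_ultrametric_on_def by auto
qed

lemma pseudo_ultrametric_restrict:
  "pseudo_ultrametric_on S (restrict d (S \<times> S)) \<longleftrightarrow> pseudo_ultrametric_on S d"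
  by (auto simp: pseudo_ultrametric_on_def Pi_iff)

text \<open>
  A pointwise maximum takes its values among those of \<open>d\<close> and \<open>{0, \<eta>}\<close>, hence in \<open>R\<close>; a sum would in
  general leave \<open>R\<close>. The restriction serves extensionality.
\<close>

lemma max_partition_dist_in_UCPM:
  assumes "d \<in> UCPM X R" "range_set R" "\<eta> \<in> R"
    and "open_covering X \<V>" "pairwise disjnt \<V>"
  shows "restrict (\<lambda>p. max (d p) (partition_dist \<V> \<eta> p)) (topspace X \<times> topspace X) \<in> UCPM X R"
    (is "restrict ?e ?S \<in> _")
proof -
  have R: "\<eta> \<ge> 0" "0 \<in> R" using assms(2,3) by (auto simp: range_set_def)
  have d: "pseudo_ultrametric_on (topspace X) d" "d \<in> ?S \<rightarrow> R"
    "continuous_map (prod_topology X X) euclideanreal d"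
    using assms(1) by (auto simp: UCPM_def continuous_map_in_subtopology)
  have \<V>: "\<Union>\<V> = topspace X" using assms(4) by (simp add: open_covering_def)
  have ultra: "pseudo_ultrametric_on (topspace X) ?e"
    by (intro pseudo_ultrametric_max pseudo_ultrametric_partition_dist d(1) assms(5) \<V> R(1))
  have "continuous_map (prod_topology X X) euclideanreal ?e"
    by (intro continuous_map_real_max d(3) continuous_map_partition_dist assms(4,5))
  then have "continuous_map (prod_topology X X) euclideanreal (restrict ?e ?S)"
    by (rule continuous_map_eq) simp
  moreover have "?e \<in> ?S \<rightarrow> {0..}" using ultra by (simp add: pseudo_ultrametric_on_def)
  ultimately have "continuous_map (prod_topology X X) (top_of_set {0..}) (restrict ?e ?S)"
    by (auto simp: continuous_map_in_subtopology Pi_iff)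
  moreover have "restrict ?e ?S \<in> ?S \<rightarrow> R"
    using d(2) R(2) assms(3) by (auto simp: partition_dist_def max_def)
  ultimately show ?thesis
    using ultra by (simp add: UCPM_def pseudo_ultrametric_restrict)
qed

text \<open>
  Points of different blocks have distance at least \<open>\<eta>\<close>, so an \<open>\<eta>\<close>-ball stays inside the block of
  its centre.
\<close>

lemma lebesgue_number_on_partition_dist:
  assumes "0 < \<eta>" "\<Union>\<V> = S" "\<And>V. V \<in> \<V> \<Longrightarrow> \<exists>C\<in>\<C>. V \<subseteq> C" "pairwise disjnt \<V>"
    and "\<And>x y. x \<in> S \<Longrightarrow> y \<in> S \<Longrightarrow> partition_dist \<V> \<eta> (x, y) \<le> e (x, y)"
  shows "lebesgue_number_on S e \<C> \<eta>"
  unfolding lebesgue_number_on_def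
proof (intro conjI ballI)
  fix x assume x: "x \<in> S"
  with assms(2) obtain V where V: "V \<in> \<V>" "x \<in> V" by blast
  have "pseudo_ball S e x \<eta> \<subseteq> V"
  proof
    fix p assume "p \<in> pseudo_ball S e x \<eta>"
    then have "partition_dist \<V> \<eta> (x, p) < \<eta>"
      using assms(5)[OF x] by (force simp: pseudo_ball_def)
    then obtain W where "W \<in> \<V>" "x \<in> W" "p \<in> W"
      by (auto simp: partition_dist_def split: if_splits)
    with V assms(4) show "p \<in> V" unfolding pairwise_def disjnt_iff by metis
  qed
  with assms(3)[OF V(1)] show "\<exists>C\<in>\<C>. pseudo_ball S e x \<eta> \<subseteq> C" by (meson subset_trans)
qed (rule assms(1))

section \<open>Openness and density\<close>

lemma openin_UL:
  assumes "range_set R"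
  shows "openin (UCPM_topology X R) (UL X \<C> R)"
  unfolding openin_UCPM_topology_iff[OF assms]
proof (intro conjI ballI)
  fix d assume "d \<in> UL X \<C> R"
  then obtain r where r: "lebesgue_number_on (topspace X) d \<C> r" by (auto simp: UL_def)
  then have "UD_ball X R d r \<subseteq> UL X \<C> R"
    unfolding UL_def using lebesgue_number_on_close UD_ball_iff[OF assms] by blast
  moreover from r have "r > 0" by (simp add: lebesgue_number_on_def)
  ultimately show "\<exists>r>0. UD_ball X R d r \<subseteq> UL X \<C> R" by blast
qed (auto simp: UL_def)

lemma UL_meets_UD_ball:
  assumes "range_set R" "ultraparacompact_space X" "open_covering X \<C>" "0 islimpt R"
    and "d \<in> UCPM X R" "0 < r"
  shows "UL X \<C> R \<inter> UD_ball X R d r \<noteq> {}"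
proof -
  obtain \<eta> where "\<eta> \<in> R" "\<eta> \<noteq> 0" "dist \<eta> 0 < r"
    using assms(4,6) unfolding islimpt_approachable by blast
  with assms(1) have \<eta>: "\<eta> \<in> R" "0 < \<eta>" "\<eta> < r" by (auto simp: range_set_def)
  obtain \<V> where \<V>: "open_covering X \<V>" "pairwise disjnt \<V>" "\<forall>V\<in>\<V>. \<exists>C\<in>\<C>. V \<subseteq> C"
    using assms(2)[unfolded ultraparacompact_space_def, rule_format, OF assms(3)]
    by (elim exE conjE)
  define e where
    "e = restrict (\<lambda>p. max (d p) (partition_dist \<V> \<eta> p)) (topspace X \<times> topspace X)"
  have e: "e \<in> UCPM X R"
    unfolding e_def by (rule max_partition_dist_in_UCPM[OF assms(5,1) \<eta>(1) \<V>(1,2)])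
  have "lebesgue_number_on (topspace X) e \<C> \<eta>"
    using \<V> \<eta>(2) by (intro lebesgue_number_on_partition_dist[where \<V> = \<V>])
      (auto simp: e_def open_covering_def)
  moreover have "close_on (topspace X) \<eta> d e"
    using \<eta>(2) by (auto simp: close_on_def e_def partition_dist_def)
  ultimately have "e \<in> UL X \<C> R \<inter> UD_ball X R d r"
    using e \<eta>(1,3) by (auto simp: UL_def UD_ball_iff[OF assms(1)])
  then show ?thesis by blast
qed

theorem theorem1p5:
  fixes X :: "'a topology" and R :: "real set" and \<C> :: "'a set set"
  assumes "range_set R"
    and "ultraparacompact_space X"
    and "Hausdorff_space X"
    and "open_covering X \<C>"
  shows "openin (UCPM_topology X R) (UL X \<C> R) \<and>
    (0 islimpt R \<longrightarrow>
      UCPM_topology X R closure_of UL X \<C> R = topspace (UCPM_topology X R))"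
proof (intro conjI impI)
  show "openin (UCPM_topology X R) (UL X \<C> R)"
    by (rule openin_UL[OF assms(1)])
  assume R: "0 islimpt R"
  show "UCPM_topology X R closure_of UL X \<C> R = topspace (UCPM_topology X R)"
    unfolding dense_intersects_open
  proof (intro allI impI, elim conjE)
    fix W assume W: "openin (UCPM_topology X R) W" "W \<noteq> {}"
    then obtain d r where "d \<in> UCPM X R" "r > 0" "UD_ball X R d r \<subseteq> W"
      unfolding openin_UCPM_topology_iff[OF assms(1)] by blast
    with UL_meets_UD_ball[OF assms(1,2,4) R] show "UL X \<C> R \<inter> W \<noteq> {}" by blast
  qed
qed

end
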